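(* Let $m,t$ be positive integers and let $\Phi=\{\varphi_i\}_{i\in[n]}$ be a spanning set for $\mathbb{C}^d$. The following are equivalent: (a) $\Phi$ is switching equivalent to a $t$-generator $C_m$-harmonic collection of vectors. (b) There exists an automorphism of $\Phi$ of cycle type $m^t$.
   Context: $[n]=\{1,\ldots,n\}$, $S_n$ is the symmetric group on $[n]$, and $C_m$ is the cyclic group of order $m$. $\Phi$ is an indexed family of $n$ vectors. Two finite families of vectors in $\mathbb{C}^d$ are switching equivalent if one is obtained from the other by applying a unitary transformation of $\mathbb{C}^d$, multiplying the vectors by unimodular scalars, and reindexing the vectors. Given a finite abelian group $\Gamma$, a unitary representation $\rho\colon\Gamma\to U(d)$, and vectors $\psi_1,\ldots,\psi_t\in\mathbb{C}^d$, the collection $\{\rho(g)\psi_i\}_{g\in\Gamma,i\in[t]}$ (indexed by $\Gamma\times[t]$) is called $t$-generator $\Gamma$-harmonic. An automorphism of $\Phi=\{\varphi_i\}_{i\in[n]}$ is a permutation $\sigma\in S_n$ for which there exist unimodular scalars $c_1,\ldots,c_n\in\mathbb{C}$ such that $\langle\varphi_i,\varphi_j\rangle=\overline{c_i}c_j\langle\varphi_{\sigma(i)},\varphi_{\sigma(j)}\rangle$ for every $i,j\in[n]$, where the inner product is conjugate-linear in the left entry. A permutation of $[n]$ has cycle type $m^t$ if it consists of exactly $t$ disjoint cycles, each of length $m$ (so $n=mt$; fixed points count as cycles of length $1$). *)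

theory Defs
  imports
    "HOL-Analysis.Analysis"
    "HOL-Algebra.Elementary_Groups"
    "HOL-Combinatorics.Orbits"
begin

(* The library inner product on complex ^ 'd is the real one; this is the Hermitian one,
   conjugate-linear in the left argument. *)
definition cinner :: "complex ^ 'd \<Rightarrow> complex ^ 'd \<Rightarrow> complex"
  where "cinner x y = (\<Sum>k\<in>UNIV. cnj (x $ k) * y $ k)"

definition conj_transpose :: "complex ^ 'd ^ 'd \<Rightarrow> complex ^ 'd ^ 'd"
  where "conj_transpose U = (\<chi> i j. cnj (U $ j $ i))"

definition unitary_matrix :: "complex ^ 'd ^ 'd \<Rightarrow> bool"
  where "unitary_matrix U \<longleftrightarrow>
    conj_transpose U ** U = mat 1 \<and> U ** conj_transpose U = mat 1"

definition unitary_group :: "(complex ^ 'd ^ 'd) monoid"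
  where "unitary_group =
    \<lparr>carrier = {U. unitary_matrix U}, monoid.mult = (**), one = mat 1\<rparr>"

(* A family is a function together with its index set. *)
definition switching_equivalent ::
    "'i set \<Rightarrow> ('i \<Rightarrow> complex ^ 'd) \<Rightarrow> 'j set \<Rightarrow> ('j \<Rightarrow> complex ^ 'd) \<Rightarrow> bool"
  where "switching_equivalent I \<Phi> J \<Psi> \<longleftrightarrow>
    (\<exists>U c \<pi>. unitary_matrix U \<and> (\<forall>i\<in>I. cmod (c i) = 1) \<and> bij_betw \<pi> I J \<and>
       (\<forall>i\<in>I. \<Psi> (\<pi> i) = c i *s (U *v \<Phi> i)))"

definition harmonic_collection ::
    "'g monoid \<Rightarrow> nat \<Rightarrow> ('g \<times> nat \<Rightarrow> complex ^ 'd) \<Rightarrow> bool"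
  where "harmonic_collection \<Gamma> t \<Psi> \<longleftrightarrow>
    comm_group \<Gamma> \<and> finite (carrier \<Gamma>) \<and>
    (\<exists>\<rho> \<in> hom \<Gamma> unitary_group. \<exists>\<psi>.
       \<forall>g\<in>carrier \<Gamma>. \<forall>i\<in>{1..t}. \<Psi> (g, i) = \<rho> g *v \<psi> i)"

definition family_automorphism ::
    "'i set \<Rightarrow> ('i \<Rightarrow> complex ^ 'd) \<Rightarrow> ('i \<Rightarrow> 'i) \<Rightarrow> bool"
  where "family_automorphism I \<Phi> \<sigma> \<longleftrightarrow>
    \<sigma> permutes I \<and>
    (\<exists>c. (\<forall>i\<in>I. cmod (c i) = 1) \<and>
       (\<forall>i\<in>I. \<forall>j\<in>I. cinner (\<Phi> i) (\<Phi> j) =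
          cnj (c i) * c j * cinner (\<Phi> (\<sigma> i)) (\<Phi> (\<sigma> j))))"

(* Cycle type m^t: the cycles of sigma, fixed points included, are its orbits on I. *)
definition uniform_cycle_type :: "'i set \<Rightarrow> ('i \<Rightarrow> 'i) \<Rightarrow> nat \<Rightarrow> nat \<Rightarrow> bool"
  where "uniform_cycle_type I \<sigma> m t \<longleftrightarrow>
    finite I \<and> \<sigma> permutes I \<and>
    card (orbit \<sigma> ` I) = t \<and> (\<forall>C \<in> orbit \<sigma> ` I. card C = m)"

end

theory Submission
  imports Defs
begin

text \<open>
  A permutation has cycle type \<open>m^t\<close> iff it is conjugate to the shift of the first coordinate on
  \<open>C_m \<times> [t]\<close>, and the generator of \<open>C_m\<close> acts on a harmonic collection by this shift. Conversely,
  an automorphism \<open>\<sigma>\<close> of a spanning family is induced, up to unimodular scalars \<open>c i\<close>, by a unitary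
  \<open>V\<close>, because the two families have the same Gram matrix. In general \<open>V^m \<noteq> 1\<close>: it multiplies the
  \<open>i\<close>-th vector by \<open>\<gamma> i\<close>, the product of the \<open>c j\<close> over the cycle of \<open>i\<close>. Dividing every \<open>c i\<close> by an
  \<open>m\<close>-th root of \<open>\<gamma> i\<close> that depends only on the value \<open>\<gamma> i\<close> leaves the Gram matrix unchanged, as
  vectors with different \<open>\<gamma> i\<close> are orthogonal, and yields a unitary with \<open>m\<close>-th power 1.
\<close>

subsection \<open>Permutations of uniform cycle type\<close>

lemma funpow_mem_invariant: "f ` A \<subseteq> A \<Longrightarrow> x \<in> A \<Longrightarrow> (f ^^ k) x \<in> A"
  by (induction k) auto

text \<open>The map \<open>q\<close> labels points by a position \<open>k\<close> in a cycle and a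
  cycle \<open>l\<close>, turning \<sigma> into the shift of the first coordinate; iterates then add
  to the position modulo \<open>m\<close>.\<close>

lemma funpow_cyclic_grid:
  fixes m :: nat
  assumes step: "\<And>k l. k < m \<Longrightarrow> l \<in> L \<Longrightarrow> \<sigma> (q (k, l)) = q (Suc k mod m, l)"
    and "k < m" "l \<in> L"
  shows "(\<sigma> ^^ j) (q (k, l)) = q ((k + j) mod m, l)"
proof (induction j)
  case 0
  then show ?case using \<open>k < m\<close> by simp
next
  case (Suc j)
  have "(k + j) mod m < m" using \<open>k < m\<close> by simp
  then show ?case using Suc step[of "(k + j) mod m" l] \<open>l \<in> L\<close>
    by (simp add: mod_Suc_eq)
qed

text \<open>Since \<open>m\<close> steps lead back to the start, the first \<open>m\<close> iterates
  exhaust the orbit, and they visit every position in column \<open>l\<close>.\<close>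

lemma orbit_cyclic_grid:
  fixes m :: nat
  assumes step: "\<And>k l. k < m \<Longrightarrow> l \<in> L \<Longrightarrow> \<sigma> (q (k, l)) = q (Suc k mod m, l)"
    and k: "k < m" and l: "l \<in> L"
  shows "orbit \<sigma> (q (k, l)) = q ` ({..<m} \<times> {l})"
proof -
  have pow: "(\<sigma> ^^ j) (q (k, l)) = q ((k + j) mod m, l)" for j
    using step k l by (rule funpow_cyclic_grid)
  have "(\<sigma> ^^ m) (q (k, l)) = q (k, l)" using pow[of m] k by simp
  then have "orbit \<sigma> (q (k, l)) = {(\<sigma> ^^ j) (q (k, l)) | j. j < m}"
    using k by (intro orbit_altdef_bounded) auto
  also have "\<dots> = q ` ({..<m} \<times> {l})"
  proof (intro equalityI subsetI)
    fix x assume "x \<in> {(\<sigma> ^^ j) (q (k, l)) | j. j < m}"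
    then show "x \<in> q ` ({..<m} \<times> {l})" using pow k by auto
  next
    fix x assume "x \<in> q ` ({..<m} \<times> {l})"
    then obtain j where j: "j < m" "x = q (j, l)" by auto
    \<comment> \<open>The exponent is the forward distance from \<open>k\<close> to
      \<open>j\<close>. Adding \<open>m\<close> avoids truncated subtraction, and reducing modulo
      \<open>m\<close> puts it within the bounded range.\<close>
    have "(k + (j + m - k) mod m) mod m = (k + (j + m - k)) mod m" by (simp add: mod_add_right_eq)
    also have "\<dots> = j" using j k by simp
    finally have "x = (\<sigma> ^^ ((j + m - k) mod m)) (q (k, l))" using pow j by simp
    then show "x \<in> {(\<sigma> ^^ j) (q (k, l)) | j. j < m}" using k by auto
  qed
  finally show ?thesis .
qed

text \<open>The orbits are the columns of the grid; injectivity of \<open>q\<close> keeps them apart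
  and gives each one \<open>m\<close> points.\<close>

lemma uniform_cycle_typeI:
  assumes "m > 0" and perm: "\<sigma> permutes I"
    and bij: "bij_betw q ({..<m} \<times> {1..t}) I"
    and step: "\<And>k l. k < m \<Longrightarrow> l \<in> {1..t} \<Longrightarrow> \<sigma> (q (k, l)) = q (Suc k mod m, l)"
  shows "uniform_cycle_type I \<sigma> m t"
proof -
  have fin: "finite I" using bij_betw_finite[OF bij] by simp
  have inj: "inj_on q ({..<m} \<times> {1..t})" and img: "q ` ({..<m} \<times> {1..t}) = I"
    using bij by (auto simp: bij_betw_def)
  let ?C = "\<lambda>l. q ` ({..<m} \<times> {l})"
  have orb: "orbit \<sigma> (q (k, l)) = ?C l" if "k < m" "l \<in> {1..t}" for k l
    using step that by (rule orbit_cyclic_grid)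
  have "orbit \<sigma> ` I = (\<lambda>(k, l). orbit \<sigma> (q (k, l))) ` ({..<m} \<times> {1..t})"
    unfolding img[symmetric] image_image by (simp add: case_prod_beta)
  also have "\<dots> = (\<lambda>(k, l). ?C l) ` ({..<m} \<times> {1..t})"
    using orb by (intro image_cong refl) (clarify, simp)
  also have "\<dots> = ?C ` {1..t}"
    using \<open>m > 0\<close> by (fastforce simp: image_iff)
  finally have orbs: "orbit \<sigma> ` I = ?C ` {1..t}" .
  have "inj_on ?C {1..t}"
  proof (rule inj_onI)
    fix l l' assume l: "l \<in> {1..t}" "l' \<in> {1..t}" "?C l = ?C l'"
    \<comment> \<open>As \<open>m > 0\<close>, columns are non-empty, so equal columns share a
      point, whose label determines the column.\<close>
    have "q (0, l) \<in> ?C l" using \<open>m > 0\<close> by auto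
    then obtain k where "k < m" "q (0, l) = q (k, l')" using l by auto
    then have "(0, l) = (k, l')" using l \<open>m > 0\<close> by (intro inj_onD[OF inj]) auto
    then show "l = l'" by simp
  qed
  then have "card (orbit \<sigma> ` I) = t" by (simp add: orbs card_image)
  moreover have "card (?C l) = m" if "l \<in> {1..t}" for l
  proof -
    have "inj_on q ({..<m} \<times> {l})" by (rule inj_on_subset[OF inj]) (use that in auto)
    then show ?thesis by (simp add: card_image card_cartesian_product)
  qed
  ultimately show ?thesis
    unfolding uniform_cycle_type_def using fin perm orbs by auto
qed

text \<open>Choose a base point \<open>r l\<close> on each cycle and let \<open>q (k, l)\<close> be
  its \<open>k\<close>-th iterate.\<close>

lemma uniform_cycle_typeE:
  assumes "uniform_cycle_type I \<sigma> m t"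
  obtains q where "bij_betw q ({..<m} \<times> {1..t}) I"
    and "\<And>k l. k < m \<Longrightarrow> l \<in> {1..t} \<Longrightarrow> \<sigma> (q (k, l)) = q (Suc k mod m, l)"
proof -
  have fin: "finite I" and perm: "\<sigma> permutes I" and t: "card (orbit \<sigma> ` I) = t"
    and m: "\<And>i. i \<in> I \<Longrightarrow> card (orbit \<sigma> i) = m"
    using assms by (auto simp: uniform_cycle_type_def)
  \<comment> \<open>\<open>orbit\<close> begins with the first iterate, so a point lies in its own
    orbit because a permutation of a finite set returns to it.\<close>
  have self: "i \<in> orbit \<sigma> i" for i
    using fin perm permutation_permutes permutation_self_in_orbit by metis
  \<comment> \<open>This distance is the least positive return time. The exponents below it
    enumerate the orbit without repetition, so it equals the size of the orbit.\<close>
  have dist: "funpow_dist1 \<sigma> i i = m" if "i \<in> I" for i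
    using m[OF that] orbit_conv_funpow_dist1[OF self, of i]
      card_image[OF inj_on_funpow_dist1[OF self, of i]]
    by (simp del: One_nat_def)
  have period: "(\<sigma> ^^ m) i = i" if "i \<in> I" for i
    using funpow_dist1_prop[OF self, of i] dist[OF that] by simp
  have orb: "orbit \<sigma> i = (\<lambda>k. (\<sigma> ^^ k) i) ` {..<m}"
    and inj: "inj_on (\<lambda>k. (\<sigma> ^^ k) i) {..<m}" if "i \<in> I" for i
    using orbit_conv_funpow_dist1[OF self, of i] inj_on_funpow_dist1[OF self, of i]
    unfolding dist[OF that] by (simp_all add: atLeast0LessThan)
  obtain h where h: "bij_betw h {1..t} (orbit \<sigma> ` I)"
    using ex_bij_betw_nat_finite_1[of "orbit \<sigma> ` I"] fin t by auto
  then have "\<forall>l\<in>{1..t}. \<exists>i\<in>I. orbit \<sigma> i = h l"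
    using bij_betwE by fastforce
  then obtain r where r: "\<And>l. l \<in> {1..t} \<Longrightarrow> r l \<in> I" "\<And>l. l \<in> {1..t} \<Longrightarrow> orbit \<sigma> (r l) = h l"
    by metis
  define q where "q = (\<lambda>(k, l). (\<sigma> ^^ k) (r l))"
  have q_orb: "q (k, l) \<in> h l" if "k < m" "l \<in> {1..t}" for k l
    using that orb[OF r(1)] r(2) by (auto simp: q_def)
  have cyc: "cyclic_on \<sigma> C" if "C \<in> orbit \<sigma> ` I" for C
    using that cyclic_on_orbit[OF perm fin] by auto
  have h_in: "h l \<in> orbit \<sigma> ` I" if "l \<in> {1..t}" for l using h that bij_betwE by blast
  have "inj_on q ({..<m} \<times> {1..t})"
  proof (rule inj_onI)
    fix x y assume xy: "x \<in> {..<m} \<times> {1..t}" "y \<in> {..<m} \<times> {1..t}" "q x = q y"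
    obtain k l k' l' where eq: "x = (k, l)" "y = (k', l')" by (cases x, cases y)
    have kl: "k \<in> {..<m}" "k' \<in> {..<m}" "l \<in> {1..t}" "l' \<in> {1..t}" "q (k, l) = q (k', l')"
      using xy by (simp_all add: eq)
    then have "q (k, l) \<in> h l" "q (k, l) \<in> h l'" using q_orb by (metis lessThan_iff)+
    then have "h l = h l'" using orbit_cyclic_eq3[OF cyc[OF h_in]] kl by metis
    then have "l = l'" using h kl by (meson bij_betw_imp_inj_on inj_onD)
    moreover have "k = k'"
      using kl \<open>l = l'\<close> inj_onD[OF inj[OF r(1)], of l k k'] by (simp add: q_def)
    ultimately show "x = y" by (simp add: eq)
  qed
  moreover have "q ` ({..<m} \<times> {1..t}) = I"
  proof (intro equalityI subsetI)
    fix x assume "x \<in> q ` ({..<m} \<times> {1..t})"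
    then obtain k l where "l \<in> {1..t}" "x = (\<sigma> ^^ k) (r l)" by (auto simp: q_def)
    then show "x \<in> I" using funpow_mem_invariant[of \<sigma> I] permutes_image[OF perm] r(1) by auto
  next
    fix i assume "i \<in> I"
    then obtain l where l: "l \<in> {1..t}" "h l = orbit \<sigma> i"
      using h by (metis bij_betw_def imageE imageI)
    then have "i \<in> orbit \<sigma> (r l)" using self r(2) by simp
    then obtain k where "k < m" "i = q (k, l)"
      using orb[OF r(1)[OF l(1)]] by (auto simp: q_def)
    then show "i \<in> q ` ({..<m} \<times> {1..t})" using l(1) by blast
  qed
  ultimately have "bij_betw q ({..<m} \<times> {1..t}) I" by (simp add: bij_betw_def)
  moreover have "\<sigma> (q (k, l)) = q (Suc k mod m, l)" if "k < m" "l \<in> {1..t}" for k l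
  proof (cases "Suc k = m")
    case True
    then have "\<sigma> (q (k, l)) = (\<sigma> ^^ m) (r l)" by (auto simp: q_def)
    then show ?thesis using True period r(1) that by (simp add: q_def)
  qed (use that in \<open>simp add: q_def\<close>)
  ultimately show thesis using that by blast
qed

subsection \<open>Hermitian geometry\<close>

lemma cinner_add_left: "cinner (x + y) z = cinner x z + cinner y z"
  by (simp add: cinner_def algebra_simps sum.distrib)

lemma cinner_add_right: "cinner x (y + z) = cinner x y + cinner x z"
  by (simp add: cinner_def algebra_simps sum.distrib)

lemma cinner_diff_left: "cinner (x - y) z = cinner x z - cinner y z"
  by (simp add: cinner_def algebra_simps sum_subtractf)

lemma cinner_diff_right: "cinner x (y - z) = cinner x y - cinner x z"
  by (simp add: cinner_def algebra_simps sum_subtractf)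

lemma cinner_scale_left: "cinner (a *s x) y = cnj a * cinner x y"
  by (simp add: cinner_def sum_distrib_left mult.assoc)

lemma cinner_scale_right: "cinner x (a *s y) = a * cinner x y"
  by (simp add: cinner_def sum_distrib_left mult.left_commute)

lemma cinner_sum_left: "cinner (\<Sum>i\<in>A. f i) y = (\<Sum>i\<in>A. cinner (f i) y)"
  by (induction A rule: infinite_finite_induct) (simp_all add: cinner_add_left, simp_all add: cinner_def)

lemma cinner_sum_right: "cinner x (\<Sum>i\<in>A. f i) = (\<Sum>i\<in>A. cinner x (f i))"
  by (induction A rule: infinite_finite_induct) (simp_all add: cinner_add_right, simp_all add: cinner_def)

lemma cinner_self_eq_0:
  assumes "cinner x x = 0"
  shows "x = 0"
proof -
  have "cinner x x = of_real (\<Sum>k\<in>UNIV. (cmod (x $ k))\<^sup>2)"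
    by (simp add: cinner_def complex_norm_square mult.commute del: of_real_power)
  then have "(\<Sum>k\<in>UNIV. (cmod (x $ k))\<^sup>2) = 0" using assms by (simp del: of_real_sum)
  then show ?thesis by (simp add: sum_nonneg_eq_0_iff vec_eq_iff)
qed

lemma cinner_conj_transpose: "cinner (A *v x) y = cinner x (conj_transpose A *v y)"
proof -
  have "cinner (A *v x) y = (\<Sum>k\<in>UNIV. \<Sum>j\<in>UNIV. cnj (A $ k $ j) * cnj (x $ j) * y $ k)"
    by (simp add: cinner_def matrix_vector_mult_def sum_distrib_right)
  also have "\<dots> = (\<Sum>j\<in>UNIV. \<Sum>k\<in>UNIV. cnj (A $ k $ j) * cnj (x $ j) * y $ k)"
    by (rule sum.swap)
  also have "\<dots> = cinner x (conj_transpose A *v y)"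
    by (simp add: cinner_def matrix_vector_mult_def conj_transpose_def sum_distrib_left mult_ac)
  finally show ?thesis .
qed

lemma unitary_matrix_cinner:
  assumes "unitary_matrix U"
  shows "cinner (U *v x) (U *v y) = cinner x y"
  using assms by (simp add: cinner_conj_transpose matrix_vector_mul_assoc unitary_matrix_def)

text \<open>The vector \<open>?z\<close> is orthogonal to everything, hence to itself, and so
  vanishes. For square matrices the left inverse is also a right inverse.\<close>

lemma unitary_matrixI_cinner:
  fixes U :: "complex ^ 'd::finite ^ 'd"
  assumes "\<And>x y. cinner (U *v x) (U *v y) = cinner x y"
  shows "unitary_matrix U"
proof -
  have "(conj_transpose U ** U) *v y = y" for y
  proof -
    let ?z = "(conj_transpose U ** U) *v y - y"
    have "cinner x ?z = 0" for x
      using assms[of x y]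
      by (simp add: cinner_diff_right cinner_conj_transpose matrix_vector_mul_assoc)
    then show ?thesis using cinner_self_eq_0[of ?z] by simp
  qed
  then have "conj_transpose U ** U = mat 1" by (simp add: matrix_eq)
  then show ?thesis using matrix_left_right_inverse by (auto simp: unitary_matrix_def)
qed

lemma unitary_matrix_mat_1: "unitary_matrix (mat 1)"
  by (rule unitary_matrixI_cinner) simp

lemma unitary_matrix_mult: "unitary_matrix U \<Longrightarrow> unitary_matrix V \<Longrightarrow> unitary_matrix (U ** V)"
  by (rule unitary_matrixI_cinner) (simp flip: matrix_vector_mul_assoc add: unitary_matrix_cinner)

section \<open>Spanning families with equal Gram matrices\<close>

text \<open>The coefficients are indexed by \<open>I\<close> and not by the set of vectors, since a
  family may repeat a vector.\<close>

lemma span_image_finite: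
  fixes x :: "'i \<Rightarrow> complex ^ 'd"
  assumes "finite I" "v \<in> vec.span (x ` I)"
  shows "\<exists>a. v = (\<Sum>i\<in>I. a i *s x i)"
  using assms(2)
proof (induction rule: vec.span_induct_alt)
  case base
  show ?case by (intro exI[of _ "\<lambda>_. 0"]) simp
next
  case (step c y v)
  then obtain a j where a: "v = (\<Sum>i\<in>I. a i *s x i)" and j: "j \<in> I" "y = x j" by auto
  have "c *s y = (\<Sum>i\<in>I. (if i = j then c else 0) *s x i)"
    using assms(1) j by (simp add: if_distrib[of "\<lambda>c. c *s _"] sum.delta cong: if_cong)
  then have "c *s y + v = (\<Sum>i\<in>I. ((if i = j then c else 0) + a i) *s x i)"
    by (simp add: a vec.scale_left_distrib sum.distrib)
  then show ?case by (rule exI[where x = "\<lambda>i. (if i = j then c else 0) + a i"])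
qed

text \<open>\<open>U\<close> replaces each \<open>x i\<close> by \<open>y i\<close> in a linear
  combination. Equality of the Gram matrices makes this an isometry.\<close>

lemma unitary_of_equal_Gram:
  fixes x y :: "'i \<Rightarrow> complex ^ 'd::finite"
  assumes fin: "finite I" and span: "vec.span (x ` I) = UNIV"
    and Gram: "\<And>i j. i \<in> I \<Longrightarrow> j \<in> I \<Longrightarrow> cinner (x i) (x j) = cinner (y i) (y j)"
  obtains U where "unitary_matrix U" "\<And>i. i \<in> I \<Longrightarrow> U *v x i = y i"
proof -
  have "\<forall>k. \<exists>a. axis k 1 = (\<Sum>i\<in>I. a i *s x i)"
    using span_image_finite[OF fin, of _ x] span by blast
  then obtain a where a: "\<And>k. axis k 1 = (\<Sum>i\<in>I. a k i *s x i)" by metis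
  \<comment> \<open>Extending fixed expansions of the standard basis makes the coefficients depend
    linearly on \<open>v\<close>, although the \<open>x i\<close> may be linearly dependent.\<close>
  define b where "b v i = (\<Sum>k\<in>UNIV. v $ k * a k i)" for v i
  have expand: "v = (\<Sum>i\<in>I. b v i *s x i)" for v
  proof -
    have "v = (\<Sum>k\<in>UNIV. v $ k *s axis k 1)" by (simp add: basis_expansion)
    also have "\<dots> = (\<Sum>k\<in>UNIV. \<Sum>i\<in>I. (v $ k * a k i) *s x i)"
      by (subst a) (simp add: vec.scale_sum_right)
    also have "\<dots> = (\<Sum>i\<in>I. b v i *s x i)"
      by (subst sum.swap) (simp add: b_def vec.scale_sum_left)
    finally show ?thesis .
  qed
  define U :: "complex ^ 'd ^ 'd" where "U = (\<chi> r k. \<Sum>i\<in>I. a k i * y i $ r)"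
  have U: "U *v v = (\<Sum>i\<in>I. b v i *s y i)" for v
  proof -
    have "(U *v v) $ r = (\<Sum>k\<in>UNIV. \<Sum>i\<in>I. v $ k * a k i * y i $ r)" for r
      by (simp add: U_def matrix_vector_mult_def sum_distrib_left sum_distrib_right mult_ac)
    also have "\<dots> r = (\<Sum>i\<in>I. b v i *s y i) $ r" for r
      by (subst sum.swap) (simp add: b_def sum_distrib_right)
    finally show ?thesis by (simp add: vec_eq_iff)
  qed
  have left: "cinner (U *v v) (y j) = cinner v (x j)" if "j \<in> I" for v j
  proof -
    have "cinner (U *v v) (y j) = (\<Sum>i\<in>I. cnj (b v i) * cinner (x i) (x j))"
      using that Gram by (simp add: U cinner_sum_left cinner_scale_left)
    also have "\<dots> = cinner (\<Sum>i\<in>I. b v i *s x i) (x j)"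
      by (simp add: cinner_sum_left cinner_scale_left)
    finally show ?thesis by (simp flip: expand)
  qed
  have iso: "cinner (U *v v) (U *v w) = cinner v w" for v w
  proof -
    have "cinner (U *v v) (U *v w) = (\<Sum>j\<in>I. b w j * cinner v (x j))"
      by (simp add: U[of w] cinner_sum_right cinner_scale_right left)
    also have "\<dots> = cinner v (\<Sum>j\<in>I. b w j *s x j)"
      by (simp add: cinner_sum_right cinner_scale_right)
    finally show ?thesis by (simp flip: expand)
  qed
  \<comment> \<open>The chosen expansion of \<open>x j\<close> need not be the trivial one, so this
    is not immediate. The squared norm of the difference expands into four terms, each
    \<open>cinner (x j) (x j)\<close> up to sign, which cancel.\<close>
  have "U *v x j = y j" if j: "j \<in> I" for j
  proof -
    have yU: "cinner (y j) (U *v v) = cinner (x j) v" for v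
    proof -
      have "cinner (y j) (U *v v) = (\<Sum>i\<in>I. b v i * cinner (x j) (x i))"
        using j Gram by (simp add: U cinner_sum_right cinner_scale_right)
      also have "\<dots> = cinner (x j) (\<Sum>i\<in>I. b v i *s x i)"
        by (simp add: cinner_sum_right cinner_scale_right)
      finally show ?thesis by (simp flip: expand)
    qed
    have "cinner (U *v x j - y j) (U *v x j - y j) = 0"
      using Gram j by (simp add: cinner_diff_left cinner_diff_right iso left yU)
    then show ?thesis using cinner_self_eq_0 by fastforce
  qed
  moreover have "unitary_matrix U" by (rule unitary_matrixI_cinner) (rule iso)
  ultimately show thesis by (rule that[rotated])
qed

subsection \<open>Powers of a matrix\<close>

text \<open>Powers are taken with respect to \<open>**\<close>; the product \<open>*\<close> on
  these types, and with it \<open>^\<close>, is entrywise.\<close>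

definition mat_pow :: "complex ^ 'd ^ 'd \<Rightarrow> nat \<Rightarrow> complex ^ 'd ^ 'd"
  where "mat_pow A k = (((**) A) ^^ k) (mat 1)"

lemma mat_pow_0 [simp]: "mat_pow A 0 = mat 1"
  and mat_pow_Suc [simp]: "mat_pow A (Suc k) = A ** mat_pow A k"
  by (simp_all add: mat_pow_def)

lemma mat_pow_add: "mat_pow A (j + k) = mat_pow A j ** mat_pow A k"
  by (induction j) (simp_all add: matrix_mul_assoc)

lemma mat_pow_mod:
  assumes "mat_pow A m = mat 1"
  shows "mat_pow A (k mod m) = mat_pow A k"
proof -
  have "mat_pow A (m * j) = mat 1" for j
    by (induction j) (simp_all add: mat_pow_add assms)
  then have "mat_pow A (m * (k div m) + k mod m) = mat_pow A (k mod m)"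
    by (simp only: mat_pow_add) simp
  then show ?thesis by simp
qed

lemma unitary_mat_pow: "unitary_matrix A \<Longrightarrow> unitary_matrix (mat_pow A k)"
  by (induction k) (simp_all add: unitary_matrix_mat_1 unitary_matrix_mult)

text \<open>For \<open>m > 0\<close> the group elements are the integers from 0 to
  \<open>m - 1\<close>, so \<open>nat\<close> loses nothing, and \<open>mat_pow A m = mat 1\<close>
  absorbs the reduction modulo \<open>m\<close> in the group law.\<close>

lemma mat_pow_hom:
  assumes "m > 0" "unitary_matrix A" "mat_pow A m = mat 1"
  shows "(\<lambda>g. mat_pow A (nat g)) \<in> hom (integer_mod_group m) unitary_group"
proof (rule homI)
  fix g h assume "g \<in> carrier (integer_mod_group m)" "h \<in> carrier (integer_mod_group m)"
  then have "nat ((g + h) mod int m) = (nat g + nat h) mod m"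
    using assms(1) by (simp add: carrier_integer_mod_group nat_mod_distrib nat_add_distrib)
  then show "mat_pow A (nat (g \<otimes>\<^bsub>integer_mod_group m\<^esub> h)) =
      mat_pow A (nat g) \<otimes>\<^bsub>unitary_group\<^esub> mat_pow A (nat h)"
    by (simp add: unitary_group_def mat_pow_mod[OF assms(3)] mat_pow_add)
qed (simp add: unitary_group_def unitary_mat_pow assms)

text \<open>Each application of \<open>A\<close> contributes one scalar along the path of
  \<open>i\<close>. After a full period, \<open>x i\<close> is an eigenvector whose eigenvalue is
  the product over the period.\<close>

lemma mat_pow_eigen_shift:
  fixes x :: "'i \<Rightarrow> complex ^ 'd::finite"
  assumes "\<And>i. i \<in> I \<Longrightarrow> A *v x i = c i *s x (\<sigma> i)" "\<sigma> ` I \<subseteq> I" "i \<in> I"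
  shows "mat_pow A k *v x i = (\<Prod>j<k. c ((\<sigma> ^^ j) i)) *s x ((\<sigma> ^^ k) i)"
proof (induction k)
  case (Suc k)
  have "(\<sigma> ^^ k) i \<in> I" by (rule funpow_mem_invariant[OF assms(2,3)])
  then show ?case using Suc assms(1)
    by (simp flip: matrix_vector_mul_assoc add: vector_scalar_commute mult.commute)
qed simp

subsection \<open>Families and their automorphisms\<close>

text \<open>The root is a function of \<open>z\<close> alone, so equal numbers receive equal roots;
  halving the argument is generalised to dividing it by \<open>m\<close>.\<close>

lemma unimodular_root:
  assumes "m > 0"
  obtains f where "\<And>z. cmod z = 1 \<Longrightarrow> f z ^ m = z" "\<And>z. cmod (f z) = 1"
proof
  show "cis (Arg z / m) ^ m = z" if "cmod z = 1" for z
    using assms that rcis_cmod_Arg[of z] by (simp add: Complex.DeMoivre rcis_def)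
qed simp

lemma unimodular_cnj_mult_eq_1_iff:
  assumes "cmod z = 1"
  shows "cnj z * w = 1 \<longleftrightarrow> w = z"
proof -
  have "z * cnj z = 1" using assms complex_norm_square[of z] by simp
  then show ?thesis by (metis mult.assoc mult.commute mult_1)
qed

text \<open>A representation of the cyclic group needs a unitary whose \<open>m\<close>-th power is
  exactly 1. The scalars obtained are the corrected ones, not those witnessing the
  automorphism.\<close>

lemma family_automorphism_unitary:
  fixes \<Phi> :: "'i \<Rightarrow> complex ^ 'd::finite"
  assumes fin: "finite I" and span: "vec.span (\<Phi> ` I) = UNIV"
    and auto: "family_automorphism I \<Phi> \<sigma>"
    and "m > 0" and period: "\<And>i. i \<in> I \<Longrightarrow> (\<sigma> ^^ m) i = i"
  obtains U c where "unitary_matrix U" "mat_pow U m = mat 1"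
    "\<And>i. i \<in> I \<Longrightarrow> cmod (c i) = 1" "\<And>i. i \<in> I \<Longrightarrow> U *v \<Phi> i = c i *s \<Phi> (\<sigma> i)"
proof -
  obtain c where perm: "\<sigma> permutes I" and c: "\<And>i. i \<in> I \<Longrightarrow> cmod (c i) = 1"
    and Gram: "\<And>i j. i \<in> I \<Longrightarrow> j \<in> I \<Longrightarrow>
      cinner (\<Phi> i) (\<Phi> j) = cnj (c i) * c j * cinner (\<Phi> (\<sigma> i)) (\<Phi> (\<sigma> j))"
    using auto unfolding family_automorphism_def by auto
  have \<sigma>I: "\<sigma> ` I \<subseteq> I" using permutes_image[OF perm] by simp
  have pow_in: "(\<sigma> ^^ k) i \<in> I" if "i \<in> I" for i k
    using funpow_mem_invariant[OF \<sigma>I that] .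
  define P where "P k i = (\<Prod>j<k. c ((\<sigma> ^^ j) i))" for k i
  define \<gamma> where "\<gamma> = P m"
  have \<gamma>_norm: "cmod (\<gamma> i) = 1" if "i \<in> I" for i
    using c pow_in[OF that] by (simp add: \<gamma>_def P_def flip: prod_norm)
  \<comment> \<open>Iterating the automorphism relation collects the scalars in \<open>P k\<close>;
    at \<open>k = m\<close> the permutation disappears.\<close>
  have "cinner (\<Phi> i) (\<Phi> j) =
      cnj (P k i) * P k j * cinner (\<Phi> ((\<sigma> ^^ k) i)) (\<Phi> ((\<sigma> ^^ k) j))"
    if "i \<in> I" "j \<in> I" for i j k
  proof (induction k)
    case (Suc k)
    then show ?case using Gram[OF pow_in[OF that(1), of k] pow_in[OF that(2), of k]]
      by (simp add: P_def mult_ac)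
  qed (simp add: P_def)
  from this[where k = m]
  have Gram_m: "cinner (\<Phi> i) (\<Phi> j) = cnj (\<gamma> i) * \<gamma> j * cinner (\<Phi> i) (\<Phi> j)"
    if "i \<in> I" "j \<in> I" for i j
    using that period by (simp add: \<gamma>_def)
  \<comment> \<open>The \<open>\<Phi> i\<close> are eigenvectors, with eigenvalues \<open>\<gamma> i\<close>, of the \<open>m\<close>-th power of any unitary
    realising \<open>\<sigma>\<close>, so the ones with different eigenvalues are orthogonal.\<close>
  have \<gamma>_eq: "\<gamma> i = \<gamma> j" if "i \<in> I" "j \<in> I" "cinner (\<Phi> i) (\<Phi> j) \<noteq> 0" for i j
    using Gram_m[OF that(1,2)] that unimodular_cnj_mult_eq_1_iff[OF \<gamma>_norm[OF that(1)], of "\<gamma> j"]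
    by simp
  \<comment> \<open>The product over \<open>m + 1\<close> steps loses its first factor in one way
    and its last in another; both factors are \<open>c i\<close> by periodicity.\<close>
  have \<gamma>_step: "\<gamma> (\<sigma> i) = \<gamma> i" if "i \<in> I" for i
  proof -
    have "c i * \<gamma> (\<sigma> i) = P (Suc m) i"
      by (simp add: \<gamma>_def P_def prod.lessThan_Suc_shift funpow_swap1 del: prod.lessThan_Suc)
    also have "\<dots> = c i * \<gamma> i" using period[OF that] by (simp add: \<gamma>_def P_def)
    finally show ?thesis using c[OF that] by auto
  qed
  have \<gamma>_pow: "\<gamma> ((\<sigma> ^^ k) i) = \<gamma> i" if "i \<in> I" for i k
    by (induction k) (simp_all add: \<gamma>_step pow_in that)
  obtain f where f: "\<And>z. cmod z = 1 \<Longrightarrow> f z ^ m = z" "\<And>z. cmod (f z) = 1"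
    using unimodular_root[OF \<open>m > 0\<close>] by metis
  define d where "d i = c i / f (\<gamma> i)" for i
  have d_norm: "cmod (d i) = 1" if "i \<in> I" for i
    using c[OF that] f(2) by (simp add: d_def norm_divide)
  \<comment> \<open>Orthogonal pairs stay orthogonal under any rescaling; for the other pairs the
    two values of \<gamma> agree, so the roots cancel.\<close>
  have "cinner (\<Phi> i) (\<Phi> j) = cinner (d i *s \<Phi> (\<sigma> i)) (d j *s \<Phi> (\<sigma> j))"
    if "i \<in> I" "j \<in> I" for i j
  proof (cases "cinner (\<Phi> i) (\<Phi> j) = 0")
    case True
    moreover have "c i \<noteq> 0" "c j \<noteq> 0" using c that norm_zero zero_neq_one by metis+
    ultimately have "cinner (\<Phi> (\<sigma> i)) (\<Phi> (\<sigma> j)) = 0" using Gram[OF that] by simp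
    then show ?thesis using True by (simp add: cinner_scale_left cinner_scale_right)
  next
    case False
    then have "cnj (f (\<gamma> i)) * f (\<gamma> j) = 1"
      using \<gamma>_eq[OF that] unimodular_cnj_mult_eq_1_iff f(2) by simp
    then have "cnj (d i) * d j = cnj (c i) * c j" by (simp add: d_def)
    then show ?thesis using Gram[OF that]
      by (simp add: cinner_scale_left cinner_scale_right flip: mult.assoc) (simp add: mult_ac)
  qed
  then obtain U where U: "unitary_matrix U" "\<And>i. i \<in> I \<Longrightarrow> U *v \<Phi> i = d i *s \<Phi> (\<sigma> i)"
    using unitary_of_equal_Gram[OF fin span, of "\<lambda>i. d i *s \<Phi> (\<sigma> i)"] by blast
  have fixed: "mat_pow U m *v \<Phi> i = \<Phi> i" if "i \<in> I" for i
  proof -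
    \<comment> \<open>As \<gamma> is constant along the cycle, the same root is divided out
      \<open>m\<close> times.\<close>
    have "(\<Prod>k<m. d ((\<sigma> ^^ k) i)) = \<gamma> i / f (\<gamma> i) ^ m"
      unfolding d_def prod_dividef \<gamma>_pow[OF that] by (simp add: \<gamma>_def P_def)
    also have "\<dots> = 1" using f(1)[OF \<gamma>_norm[OF that]] \<gamma>_norm[OF that] by auto
    finally show ?thesis
      using mat_pow_eigen_shift[where \<sigma> = \<sigma> and c = d and k = m, OF U(2) \<sigma>I that]
      by (simp add: period[OF that])
  qed
  have "mat_pow U m *v v = v" for v
  proof -
    have "v \<in> vec.span (\<Phi> ` I)" using span by simp
    then show ?thesis
    proof (induction rule: vec.span_induct_alt)
      case (step a x y)
      then show ?case using fixed
        by (auto simp: matrix_vector_right_distrib vector_scalar_commute)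
    qed simp
  qed
  then have "mat_pow U m = mat 1" by (simp add: matrix_eq)
  then show thesis using that U d_norm by blast
qed

text \<open>The generator acts on the harmonic collection by a unitary, hence preserves inner
  products, while shifting the group coordinate. Pulling this shift back along the switching
  equivalence gives \<sigma>.\<close>

lemma automorphism_of_harmonic:
  fixes \<Phi> :: "'i \<Rightarrow> complex ^ 'd::finite"
  assumes "m > 0" and harm: "harmonic_collection (integer_mod_group m) t \<Psi>"
    and equiv: "switching_equivalent I \<Phi> (carrier (integer_mod_group m) \<times> {1..t}) \<Psi>"
  shows "\<exists>\<sigma>. family_automorphism I \<Phi> \<sigma> \<and> uniform_cycle_type I \<sigma> m t"
proof -
  let ?G = "integer_mod_group m" and ?J = "{..<m} \<times> {1..t}"
  obtain \<rho> \<psi> where \<rho>: "\<rho> \<in> hom ?G unitary_group"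
    and \<Psi>: "\<And>g l. g \<in> carrier ?G \<Longrightarrow> l \<in> {1..t} \<Longrightarrow> \<Psi> (g, l) = \<rho> g *v \<psi> l"
    using harm unfolding harmonic_collection_def by blast
  obtain U c \<pi> where U: "unitary_matrix U" and c: "\<And>i. i \<in> I \<Longrightarrow> cmod (c i) = 1"
    and \<pi>: "bij_betw \<pi> I (carrier ?G \<times> {1..t})"
    and \<Psi>\<pi>: "\<And>i. i \<in> I \<Longrightarrow> \<Psi> (\<pi> i) = c i *s (U *v \<Phi> i)"
    using equiv unfolding switching_equivalent_def by blast
  have carrier: "int k \<in> carrier ?G" if "k < m" for k
    using that by (simp add: carrier_integer_mod_group)
  have "bij_betw (\<lambda>(k, l). (int k, l)) ?J (carrier ?G \<times> {1..t})"
    using \<open>m > 0\<close>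
    by (intro bij_betw_byWitness[where f' = "\<lambda>(g, l). (nat g, l)"])
      (auto simp: carrier_integer_mod_group)
  from bij_betw_trans[OF this bij_betw_inv_into[OF \<pi>]]
  obtain q where q: "bij_betw q ?J I" and \<pi>q: "\<And>k l. k < m \<Longrightarrow> l \<in> {1..t} \<Longrightarrow> \<pi> (q (k, l)) = (int k, l)"
  proof
    fix k l assume "k < m" "l \<in> {1..t}"
    then show "\<pi> ((inv_into I \<pi> \<circ> (\<lambda>(k, l). (int k, l))) (k, l)) = (int k, l)"
      using bij_betw_inv_into_right[OF \<pi>] carrier by simp
  qed
  define p where "p = inv_into ?J q"
  have pq: "p (q x) = x" if "x \<in> ?J" for x
    unfolding p_def by (rule bij_betw_inv_into_left[OF q that])
  have I_eq: "I = q ` ?J" using q by (simp add: bij_betw_def)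
  \<comment> \<open>This is the shift transported by \<open>q\<close>, extended by the identity
    outside \<open>I\<close> as \<open>permutes\<close> demands.\<close>
  define \<sigma> where "\<sigma> i = (if i \<in> I then q (map_prod (\<lambda>k. Suc k mod m) id (p i)) else i)" for i
  have step: "\<sigma> (q (k, l)) = q (Suc k mod m, l)" if "k < m" "l \<in> {1..t}" for k l
    using that pq[of "(k, l)"] by (auto simp: \<sigma>_def I_eq)
  have "\<sigma> permutes I"
  proof (rule bij_imp_permutes)
    have surj: "\<sigma> ` I = I"
    proof (intro equalityI subsetI)
      fix i assume "i \<in> \<sigma> ` I"
      then show "i \<in> I" using step \<open>m > 0\<close> unfolding I_eq by auto
    next
      fix i assume "i \<in> I"
      then obtain k l where kl: "k < m" "l \<in> {1..t}" "i = q (k, l)" by (auto simp: I_eq)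
      \<comment> \<open>The cyclic predecessor of \<open>k\<close>; adding \<open>m\<close> covers
        \<open>k = 0\<close>.\<close>
      let ?k = "(k + m - 1) mod m"
      have "Suc ?k mod m = Suc (k + m - 1) mod m" by (rule mod_Suc_eq)
      also have "\<dots> = k" using kl \<open>m > 0\<close> by simp
      finally have "i = \<sigma> (q (?k, l))" using step kl \<open>m > 0\<close> by simp
      then show "i \<in> \<sigma> ` I" using kl \<open>m > 0\<close> unfolding I_eq by auto
    qed
    have "finite I" using bij_betw_finite[OF q] by simp
    then show "bij_betw \<sigma> I I" using surj by (simp add: bij_betw_def finite_surj_inj)
  qed (simp add: \<sigma>_def)
  have shift: "\<Psi> (\<pi> (\<sigma> i)) = \<rho> (1 mod int m) *v \<Psi> (\<pi> i)" if "i \<in> I" for i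
  proof -
    obtain k l where kl: "k < m" "l \<in> {1..t}" "i = q (k, l)" using \<open>i \<in> I\<close> by (auto simp: I_eq)
    \<comment> \<open>The generator is written \<open>1 mod int m\<close> because for
      \<open>m = 1\<close> the integer 1 lies outside the carrier.\<close>
    have one: "1 mod int m \<in> carrier ?G" using \<open>m > 0\<close> by (simp add: carrier_integer_mod_group)
    have "\<pi> (\<sigma> i) = (int (Suc k mod m), l)" using kl step \<pi>q \<open>m > 0\<close> by simp
    moreover have "\<rho> (int (Suc k mod m)) = \<rho> (1 mod int m) ** \<rho> (int k)"
      using hom_mult[OF \<rho> one carrier[OF kl(1)]]
      by (simp add: unitary_group_def zmod_int mod_add_left_eq)
    ultimately show ?thesis
      using kl \<pi>q \<Psi> carrier \<open>m > 0\<close> by (simp add: matrix_vector_mul_assoc)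
  qed
  have "\<rho> (1 mod int m) \<in> carrier unitary_group"
    using \<rho> \<open>m > 0\<close> by (intro hom_in_carrier[OF \<rho>]) (simp add: carrier_integer_mod_group)
  then have \<rho>1: "unitary_matrix (\<rho> (1 mod int m))" by (simp add: unitary_group_def)
  have \<sigma>I: "\<sigma> i \<in> I" if "i \<in> I" for i using permutes_in_image[OF \<open>\<sigma> permutes I\<close>] that by simp
  have \<Psi>_inner: "cinner (\<Psi> (\<pi> i)) (\<Psi> (\<pi> j)) = cnj (c i) * c j * cinner (\<Phi> i) (\<Phi> j)"
    if "i \<in> I" "j \<in> I" for i j
    using that by (simp add: \<Psi>\<pi> cinner_scale_left cinner_scale_right unitary_matrix_cinner[OF U])
  \<comment> \<open>Undo the switching scalar at \<open>i\<close>, shift, then apply the one at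
    \<open>\<sigma> i\<close>: this yields \<open>cnj (c i) * c (\<sigma> i)\<close>.\<close>
  have "cinner (\<Phi> i) (\<Phi> j) =
      cnj (cnj (c i) * c (\<sigma> i)) * (cnj (c j) * c (\<sigma> j)) * cinner (\<Phi> (\<sigma> i)) (\<Phi> (\<sigma> j))"
    if "i \<in> I" "j \<in> I" for i j
  proof -
    have cc: "cnj (c k) * c k = 1" if "k \<in> I" for k
      using c[OF that] unimodular_cnj_mult_eq_1_iff by blast
    have "cinner (\<Phi> i) (\<Phi> j) = (cnj (c i) * c i) * (cnj (c j) * c j) * cinner (\<Phi> i) (\<Phi> j)"
      using cc that by simp
    also have "\<dots> = c i * cnj (c j) * cinner (\<Psi> (\<pi> i)) (\<Psi> (\<pi> j))"
      by (simp add: \<Psi>_inner that mult_ac)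
    also have "cinner (\<Psi> (\<pi> i)) (\<Psi> (\<pi> j)) = cinner (\<Psi> (\<pi> (\<sigma> i))) (\<Psi> (\<pi> (\<sigma> j)))"
      using that by (simp add: shift unitary_matrix_cinner[OF \<rho>1])
    finally show ?thesis using that by (simp add: \<Psi>_inner \<sigma>I mult_ac)
  qed
  then have "family_automorphism I \<Phi> \<sigma>"
    unfolding family_automorphism_def using \<open>\<sigma> permutes I\<close> c \<sigma>I
    by (intro conjI exI[of _ "\<lambda>i. cnj (c i) * c (\<sigma> i)"]) (auto simp: norm_mult)
  then show ?thesis using uniform_cycle_typeI[OF \<open>m > 0\<close> \<open>\<sigma> permutes I\<close> q step] by blast
qed

text \<open>One vector from each cycle serves as generator, and \<open>U\<close> represents the
  generator of the group. The powers of \<open>U\<close> reproduce \<Phi> up to phases, so the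
  switching uses the identity matrix.\<close>

lemma harmonic_of_automorphism:
  fixes \<Phi> :: "'i \<Rightarrow> complex ^ 'd::finite"
  assumes "m > 0" and span: "vec.span (\<Phi> ` I) = UNIV"
    and auto: "family_automorphism I \<Phi> \<sigma>" and cyc: "uniform_cycle_type I \<sigma> m t"
  shows "\<exists>\<Psi>. harmonic_collection (integer_mod_group m) t \<Psi> \<and>
    switching_equivalent I \<Phi> (carrier (integer_mod_group m) \<times> {1..t}) \<Psi>"
proof -
  let ?G = "integer_mod_group m" and ?J = "{..<m} \<times> {1..t}"
  have fin: "finite I" and perm: "\<sigma> permutes I" using cyc by (auto simp: uniform_cycle_type_def)
  obtain q where q: "bij_betw q ?J I"
    and step: "\<And>k l. k < m \<Longrightarrow> l \<in> {1..t} \<Longrightarrow> \<sigma> (q (k, l)) = q (Suc k mod m, l)"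
    using uniform_cycle_typeE[OF cyc] by blast
  have pow: "(\<sigma> ^^ j) (q (k, l)) = q ((k + j) mod m, l)" if "k < m" "l \<in> {1..t}" for j k l
    using step that by (rule funpow_cyclic_grid)
  have I_eq: "I = q ` ?J" using q by (simp add: bij_betw_def)
  have "(\<sigma> ^^ m) i = i" if "i \<in> I" for i
    using that pow unfolding I_eq by auto
  then obtain U c where U: "unitary_matrix U" "mat_pow U m = mat 1"
    and c: "\<And>i. i \<in> I \<Longrightarrow> cmod (c i) = 1"
    and U\<Phi>: "\<And>i. i \<in> I \<Longrightarrow> U *v \<Phi> i = c i *s \<Phi> (\<sigma> i)"
    using family_automorphism_unitary[OF fin span auto \<open>m > 0\<close>] by metis
  define \<Psi> where "\<Psi> = (\<lambda>(g, l). mat_pow U (nat g) *v \<Phi> (q (0, l)))"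
  define p where "p = inv_into ?J q"
  have p: "bij_betw p I ?J" unfolding p_def by (rule bij_betw_inv_into[OF q])
  have qp: "q (p i) = i" if "i \<in> I" for i
    unfolding p_def by (rule bij_betw_inv_into_right[OF q that])
  have "bij_betw (\<lambda>(k, l). (int k, l)) ?J (carrier ?G \<times> {1..t})"
    using \<open>m > 0\<close>
    by (intro bij_betw_byWitness[where f' = "\<lambda>(g, l). (nat g, l)"])
      (auto simp: carrier_integer_mod_group)
  from bij_betw_trans[OF p this]
  have \<pi>: "bij_betw (map_prod int id \<circ> p) I (carrier ?G \<times> {1..t})"
    by (simp add: map_prod_def id_def)
  have q0: "q (0, l) \<in> I" if "l \<in> {1..t}" for l using that \<open>m > 0\<close> by (auto simp: I_eq)
  \<comment> \<open>The phase gathered while \<open>U\<close> moves the base point of the cycle to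
    \<open>i\<close>.\<close>
  define e where "e i = (\<Prod>j<fst (p i). c ((\<sigma> ^^ j) (q (0, snd (p i)))))" for i
  have p_in: "fst (p i) < m" "snd (p i) \<in> {1..t}" if "i \<in> I" for i
    using bij_betwE[OF p] that by (auto simp: mem_Times_iff)
  have "cmod (e i) = 1" if "i \<in> I" for i
  proof -
    have "(\<sigma> ^^ j) (q (0, snd (p i))) \<in> I" for j
      using permutes_image[OF perm] q0 p_in(2)[OF that] by (intro funpow_mem_invariant) auto
    then show ?thesis using c by (simp add: e_def prod_norm[symmetric])
  qed
  moreover have "\<Psi> ((map_prod int id \<circ> p) i) = e i *s (mat 1 *v \<Phi> i)" if "i \<in> I" for i
  proof -
    obtain k l where kl: "p i = (k, l)" "k < m" "l \<in> {1..t}"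
      using p_in[OF \<open>i \<in> I\<close>] by (cases "p i") auto
    have \<sigma>I: "\<sigma> ` I \<subseteq> I" using permutes_image[OF perm] by simp
    have "\<Psi> ((map_prod int id \<circ> p) i) = e i *s \<Phi> ((\<sigma> ^^ k) (q (0, l)))"
      using mat_pow_eigen_shift[where \<sigma> = \<sigma> and c = c, OF U\<Phi> \<sigma>I q0[OF kl(3)], of k] kl by (simp add: \<Psi>_def e_def)
    then show ?thesis using pow[of 0 l k] kl qp[OF that] by simp
  qed
  ultimately have "switching_equivalent I \<Phi> (carrier ?G \<times> {1..t}) \<Psi>"
    unfolding switching_equivalent_def using \<pi> unitary_matrix_mat_1 by blast
  moreover have "harmonic_collection ?G t \<Psi>"
    unfolding harmonic_collection_def
  proof (intro conjI bexI exI ballI)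
    show "finite (carrier ?G)" using \<open>m > 0\<close> by (simp add: carrier_integer_mod_group)
    show "\<Psi> (g, l) = mat_pow U (nat g) *v \<Phi> (q (0, l))" for g l by (simp add: \<Psi>_def)
    show "(\<lambda>g. mat_pow U (nat g)) \<in> hom ?G unitary_group" by (rule mat_pow_hom[OF \<open>m > 0\<close> U])
  qed simp
  ultimately show ?thesis by blast
qed

theorem theorem25:
  fixes m t n :: nat and \<Phi> :: "nat \<Rightarrow> complex ^ 'd::finite"
  assumes "m > 0" and "t > 0"
    and "vec.span (\<Phi> ` {1..n}) = UNIV"
  shows "(\<exists>\<Psi> :: int \<times> nat \<Rightarrow> complex ^ 'd.
            harmonic_collection (integer_mod_group m) t \<Psi> \<and>
            switching_equivalent {1..n} \<Phi> (carrier (integer_mod_group m) \<times> {1..t}) \<Psi>)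
       \<longleftrightarrow>
         (\<exists>\<sigma>. family_automorphism {1..n} \<Phi> \<sigma> \<and> uniform_cycle_type {1..n} \<sigma> m t)"
  using automorphism_of_harmonic[OF assms(1)] harmonic_of_automorphism[OF assms(1,3)] by blast

end
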